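(* Let $\Phi$ be a metric space endowed with a metric $d$, let $M$ be a real-valued function on $\Phi$ and $\{M_n(\phi),\ \phi\in\Phi\}$ be a sequence of real-valued processes. Assume that there exists $\beta\in\Phi$ such that (i) $\sup_{\phi\in\Phi}\{M(\phi)-M_n(\phi)\}_+\to0$ in probability; (ii) $M_n(\beta)\to M(\beta)$ in probability; (iii) for all $\epsilon>0$, $\inf\{M(\phi):\phi\in\Phi,\ d(\phi,\beta)\ge\epsilon\}>M(\beta)$. Let $(J_n)$ be a sequence of non-negative functions defined on $\Phi$ such that $J_n(\beta)\to0$, and set $$\Lambda_n(\phi,t)=M_n(\phi)+t\,J_n(\phi),\qquad \phi\in\Phi,\ t\ge0.$$ Let $T$ be a compact subset of $[0,\infty)$ and suppose that, for each $n$, $\{\widehat\beta_n(t),\ t\ge0\}$ is a $\Phi$-valued process such that $$\sup_{t\in T}\{\Lambda_n(\widehat\beta_n(t),t)-\Lambda_n(\beta,t)\}_+\to0\quad\text{in }P^*\text{-probability}.$$ Then $\widehat\beta_n(t)$ converges to $\beta$ uniformly in $t\in T$, in $P^*$-probability, that is, $$\sup_{t\in T}d(\widehat\beta_n(t),\beta)\to0\quad\text{in }P^*\text{-probability}.$$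
   Context: All processes are defined on a probability space $(\Omega,\mathcal F,P)$; the functions $J_n$ are deterministic. $a_+=\max(0,a)$. For $A\subseteq\Omega$, the outer probability is $P^*(A)=\inf\{P(B):B\in\mathcal F,\ A\subset B\}$. A sequence $(Y_n)$ of real-valued (not necessarily measurable) maps on $\Omega$ converges to $0$ in $P^*$-probability if $P^*(|Y_n|\ge\epsilon)\to0$ for every $\epsilon>0$. *)

theory Defs
  imports "HOL-Probability.Probability"
begin

text \<open>
  The maps here need not be measurable. The library's \<^const>\<open>outer_measure_of\<close> is the infimum of
  the measures of the measurable supersets, i.e. the outer probability when \<open>P\<close> is a probability
  space. Non-negative maps are taken with values in \<^typ>\<open>ennreal\<close>, so that suprema may be infinite and
  the supremum of an empty family is 0.
\<close>

definition outer_prob_tendsto_0 :: "'w measure \<Rightarrow> (nat \<Rightarrow> 'w \<Rightarrow> ennreal) \<Rightarrow> bool" where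
  "outer_prob_tendsto_0 P Y \<longleftrightarrow>
     (\<forall>\<epsilon>::real. \<epsilon> > 0 \<longrightarrow>
        (\<lambda>n. outer_measure_of P {\<omega> \<in> space P. ennreal \<epsilon> \<le> Y n \<omega>}) \<longlonglongrightarrow> 0)"

definition tendsto_in_prob :: "'w measure \<Rightarrow> (nat \<Rightarrow> 'w \<Rightarrow> real) \<Rightarrow> real \<Rightarrow> bool" where
  "tendsto_in_prob P X c \<longleftrightarrow>
     (\<forall>\<epsilon>>0. (\<lambda>n. measure P {\<omega> \<in> space P. \<epsilon> \<le> \<bar>X n \<omega> - c\<bar>}) \<longlonglongrightarrow> 0)"

end

theory Submission
  imports Defs
begin

text \<open>
  A sample point at which some \<open>\<beta>hat n t\<close> is far from \<open>\<beta>\<close> pays a fixed price in \<open>M\<close>: by the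
  well-separation of the minimum, \<open>M (\<beta>hat n t) \<ge> M \<beta> + 4 * \<eta>\<close> with \<open>\<eta> > 0\<close> depending only on
  the distance.
  On the other hand, since the penalty at \<open>\<beta>hat n t\<close> is non-negative,
  \<^item> \<open>M (\<beta>hat n t) - Mn n (\<beta>hat n t)\<close> is at most the one-sided uniform deviation \<open>a\<close>,
  \<^item> \<open>Mn n (\<beta>hat n t) - Mn n \<beta> - t * J n \<beta>\<close> is at most the optimisation error \<open>b\<close>,
  \<^item> \<open>Mn n \<beta> - M \<beta>\<close> is at most its absolute value \<open>c\<close>.

  Summing, \<open>4 * \<eta> \<le> a + b + c + t * J n \<beta>\<close>. As \<open>T\<close> is bounded, the last term is below \<open>\<eta>\<close> for
  every \<open>t\<close> in \<open>T\<close> and all large \<open>n\<close>, so that one of \<open>a\<close>, \<open>b\<close>, \<open>c\<close> is at least \<open>\<eta>\<close>. The outer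
  probability of each of these three events vanishes in the limit, hence so does that of their union
  and of anything inside it (lemmas \<open>outer_measure_of_Un_le\<close> and \<open>outer_measure_tendsto_0_cover3\<close>).
  Since the inequality holds at each sample point and each \<open>t\<close> separately, it covers the suprema
  over \<open>T\<close> even when they are not measurable.
\<close>

lemma outer_measure_of_Un_le:
  "outer_measure_of P (A \<union> B) \<le> outer_measure_of P A + outer_measure_of P B"
proof (cases "A \<subseteq> space P \<and> B \<subseteq> space P")
  case True
  then obtain A' B' where "A' \<in> sets P" "A \<subseteq> A'" "outer_measure_of P A = emeasure P A'"
    and "B' \<in> sets P" "B \<subseteq> B'" "outer_measure_of P B = emeasure P B'"
    using outer_measure_of_attain[of A P] outer_measure_of_attain[of B P] by blast
  moreover from this have "outer_measure_of P (A \<union> B) \<le> emeasure P (A' \<union> B')"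
    unfolding outer_measure_of_def by (intro INF_lower) auto
  ultimately show ?thesis
    using emeasure_subadditive[of A' P B'] by auto
next
  \<comment> \<open>A set that leaves the space has no measurable superset, and the infimum over no sets is \<open>\<top>\<close>.\<close>
  case False
  have "outer_measure_of P D = \<top>" if "\<not> D \<subseteq> space P" for D
  proof -
    have "{E \<in> sets P. D \<subseteq> E} = {}"
      using that sets.sets_into_space[of _ P] by blast
    then show ?thesis
      unfolding outer_measure_of_def by (simp only: image_empty Inf_empty)
  qed
  with False have "outer_measure_of P A = \<top> \<or> outer_measure_of P B = \<top>" by blast
  then show ?thesis by auto
qed

text \<open>
  The inclusion is asked for large \<open>n\<close> only, because the deterministic penalty term is small
  only from some index on.
\<close>
lemma outer_measure_tendsto_0_cover3:
  assumes A: "(\<lambda>n. outer_measure_of P (A n)) \<longlonglongrightarrow> 0"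
    and B: "(\<lambda>n. outer_measure_of P (B n)) \<longlonglongrightarrow> 0"
    and C: "(\<lambda>n. outer_measure_of P (C n)) \<longlonglongrightarrow> 0"
    and cover: "\<forall>\<^sub>F n in sequentially. S n \<subseteq> A n \<union> B n \<union> C n"
  shows "(\<lambda>n. outer_measure_of P (S n)) \<longlonglongrightarrow> 0"
proof (rule tendsto_sandwich[OF _ _ tendsto_const])
  show "(\<lambda>n. outer_measure_of P (A n) + outer_measure_of P (B n) + outer_measure_of P (C n))
          \<longlonglongrightarrow> 0"
    using tendsto_add[OF tendsto_add[OF A B] C] by simp
  show "\<forall>\<^sub>F n in sequentially. outer_measure_of P (S n)
          \<le> outer_measure_of P (A n) + outer_measure_of P (B n) + outer_measure_of P (C n)"
    using cover
  proof eventually_elim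
    case (elim n)
    have "outer_measure_of P (S n) \<le> outer_measure_of P (A n \<union> B n \<union> C n)"
      by (rule outer_measure_of_mono[OF elim])
    also have "\<dots> \<le> outer_measure_of P (A n) + outer_measure_of P (B n) + outer_measure_of P (C n)"
      by (meson outer_measure_of_Un_le add_right_mono order_trans)
    finally show ?case .
  qed
qed simp

text \<open>On measurable sets outer probability is probability; this brings the convergence at
  \<open>\<beta>\<close> into the same form as the other hypotheses, so that the three events can be added up.\<close>
lemma tendsto_in_prob_imp_outer_prob:
  assumes "prob_space P" and X: "\<And>n. X n \<in> borel_measurable P"
    and lim: "tendsto_in_prob P X c"
  shows "outer_prob_tendsto_0 P (\<lambda>n \<omega>. ennreal \<bar>X n \<omega> - c\<bar>)"
  unfolding outer_prob_tendsto_0_def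
proof (intro allI impI)
  fix \<epsilon> :: real assume "\<epsilon> > 0"
  interpret prob_space P by fact
  have "outer_measure_of P {\<omega> \<in> space P. ennreal \<epsilon> \<le> ennreal \<bar>X n \<omega> - c\<bar>}
      = ennreal (measure P {\<omega> \<in> space P. \<epsilon> \<le> \<bar>X n \<omega> - c\<bar>})" for n
  proof -
    have "{\<omega> \<in> space P. ennreal \<epsilon> \<le> ennreal \<bar>X n \<omega> - c\<bar>} = {\<omega> \<in> space P. \<epsilon> \<le> \<bar>X n \<omega> - c\<bar>}"
      by (simp add: ennreal_le_iff)
    moreover have "{\<omega> \<in> space P. \<epsilon> \<le> \<bar>X n \<omega> - c\<bar>} \<in> sets P"
      using X[of n] by measurable
    ultimately show ?thesis
      by (simp add: emeasure_eq_measure)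
  qed
  moreover have "(\<lambda>n. ennreal (measure P {\<omega> \<in> space P. \<epsilon> \<le> \<bar>X n \<omega> - c\<bar>})) \<longlonglongrightarrow> ennreal 0"
    using lim \<open>\<epsilon> > 0\<close> unfolding tendsto_in_prob_def by (intro tendsto_ennrealI) auto
  ultimately show "(\<lambda>n. outer_measure_of P {\<omega> \<in> space P. ennreal \<epsilon> \<le> ennreal \<bar>X n \<omega> - c\<bar>}) \<longlonglongrightarrow> 0"
    by simp
qed

lemma less_if_SUP_pos_part_less:
  fixes f :: "'a \<Rightarrow> real"
  assumes "(SUP x\<in>S. ennreal (max 0 (f x))) < ennreal r" and "x \<in> S"
  shows "f x < r"
proof -
  have "ennreal (max 0 (f x)) < ennreal r"
    using assms by (meson SUP_upper le_less_trans)
  then have "max 0 (f x) < r"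
    by (subst (asm) ennreal_less_iff) simp_all
  then show ?thesis by simp
qed

theorem theorem4:
  fixes P :: "'w measure"
    and \<Phi> :: "'a set"
    and d :: "'a \<Rightarrow> 'a \<Rightarrow> real"
    and M :: "'a \<Rightarrow> real"
    and Mn :: "nat \<Rightarrow> 'a \<Rightarrow> 'w \<Rightarrow> real"
    and \<beta> :: 'a
    and J :: "nat \<Rightarrow> 'a \<Rightarrow> real"
    and \<Lambda> :: "nat \<Rightarrow> 'a \<Rightarrow> real \<Rightarrow> 'w \<Rightarrow> real"
    and T :: "real set"
    and \<beta>hat :: "nat \<Rightarrow> real \<Rightarrow> 'w \<Rightarrow> 'a"
  assumes "prob_space P"
    and "Metric_space \<Phi> d"
    and "\<And>n \<phi>. \<phi> \<in> \<Phi> \<Longrightarrow> Mn n \<phi> \<in> borel_measurable P"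
    and "\<beta> \<in> \<Phi>"
    and "outer_prob_tendsto_0 P (\<lambda>n \<omega>. SUP \<phi>\<in>\<Phi>. ennreal (max 0 (M \<phi> - Mn n \<phi> \<omega>)))"
    and "tendsto_in_prob P (\<lambda>n. Mn n \<beta>) (M \<beta>)"
    and "\<And>\<epsilon>. \<epsilon> > 0 \<Longrightarrow> (INF \<phi>\<in>{\<phi>\<in>\<Phi>. d \<phi> \<beta> \<ge> \<epsilon>}. ereal (M \<phi>)) > ereal (M \<beta>)"
    and "\<And>n \<phi>. \<phi> \<in> \<Phi> \<Longrightarrow> J n \<phi> \<ge> 0"
    and "(\<lambda>n. J n \<beta>) \<longlonglongrightarrow> 0"
    and "\<And>n \<phi> t \<omega>. \<phi> \<in> \<Phi> \<Longrightarrow> t \<ge> 0 \<Longrightarrow> \<omega> \<in> space P \<Longrightarrow>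
           \<Lambda> n \<phi> t \<omega> = Mn n \<phi> \<omega> + t * J n \<phi>"
    and "compact T"
    and "T \<subseteq> {0..}"
    and "\<And>n t \<omega>. t \<ge> 0 \<Longrightarrow> \<omega> \<in> space P \<Longrightarrow> \<beta>hat n t \<omega> \<in> \<Phi>"
    and "outer_prob_tendsto_0 P
           (\<lambda>n \<omega>. SUP t\<in>T. ennreal (max 0 (\<Lambda> n (\<beta>hat n t \<omega>) t \<omega> - \<Lambda> n \<beta> t \<omega>)))"
  shows "outer_prob_tendsto_0 P (\<lambda>n \<omega>. SUP t\<in>T. ennreal (d (\<beta>hat n t \<omega>) \<beta>))"
  unfolding outer_prob_tendsto_0_def
proof (intro allI impI)
  fix \<epsilon> :: real assume "\<epsilon> > 0"
  \<comment> \<open>A supremum that is at least \<open>\<epsilon>\<close> need not be attained, but some \<open>t\<close> has a value above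
    \<open>\<epsilon> / 2\<close>; hence the separation is taken at radius \<open>\<epsilon> / 2\<close>.\<close>
  obtain m where m: "M \<beta> < m" and m_le: "\<And>\<phi>. \<phi> \<in> \<Phi> \<Longrightarrow> d \<phi> \<beta> \<ge> \<epsilon> / 2 \<Longrightarrow> m \<le> M \<phi>"
  proof -
    obtain m where "ereal (M \<beta>) < ereal m"
      and *: "ereal m < (INF \<phi>\<in>{\<phi>\<in>\<Phi>. d \<phi> \<beta> \<ge> \<epsilon> / 2}. ereal (M \<phi>))"
      using ereal_dense2[OF assms(7)[of "\<epsilon> / 2"]] \<open>\<epsilon> > 0\<close> by auto
    moreover have "m \<le> M \<phi>" if "\<phi> \<in> \<Phi>" "d \<phi> \<beta> \<ge> \<epsilon> / 2" for \<phi>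
    proof -
      have "ereal m < ereal (M \<phi>)"
        using * by (rule less_INF_D) (use that in auto)
      then show ?thesis by simp
    qed
    ultimately show ?thesis using that by simp
  qed
  define \<eta> where "\<eta> = (m - M \<beta>) / 4"
  have \<eta>: "\<eta> > 0" using m by (simp add: \<eta>_def)
  obtain K where K: "\<And>t. t \<in> T \<Longrightarrow> t \<le> K"
    using bounded_imp_bdd_above[OF compact_imp_bounded[OF assms(11)]] by (auto simp: bdd_above_def)
  let ?A = "\<lambda>n. {\<omega> \<in> space P. ennreal \<eta> \<le> (SUP \<phi>\<in>\<Phi>. ennreal (max 0 (M \<phi> - Mn n \<phi> \<omega>)))}"
  let ?B = "\<lambda>n. {\<omega> \<in> space P. ennreal \<eta> \<le>
              (SUP t\<in>T. ennreal (max 0 (\<Lambda> n (\<beta>hat n t \<omega>) t \<omega> - \<Lambda> n \<beta> t \<omega>)))}"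
  let ?C = "\<lambda>n. {\<omega> \<in> space P. ennreal \<eta> \<le> ennreal \<bar>Mn n \<beta> \<omega> - M \<beta>\<bar>}"
  let ?S = "\<lambda>n. {\<omega> \<in> space P. ennreal \<epsilon> \<le> (SUP t\<in>T. ennreal (d (\<beta>hat n t \<omega>) \<beta>))}"
  have "(\<lambda>n. K * J n \<beta>) \<longlonglongrightarrow> 0"
    using tendsto_mult_left[OF assms(9), of K] by simp
  then have "\<forall>\<^sub>F n in sequentially. K * J n \<beta> < \<eta>"
    using \<eta> by (rule order_tendstoD)
  then have cover: "\<forall>\<^sub>F n in sequentially. ?S n \<subseteq> ?A n \<union> ?B n \<union> ?C n"
  proof eventually_elim
    case (elim n)
    show ?case
    proof (rule subsetI, rule ccontr)
      fix \<omega> assume S: "\<omega> \<in> ?S n" and out: "\<omega> \<notin> ?A n \<union> ?B n \<union> ?C n"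
      then have \<omega>: "\<omega> \<in> space P" by simp
      have "ennreal (\<epsilon> / 2) < ennreal \<epsilon>"
        using \<open>\<epsilon> > 0\<close> by (simp add: ennreal_less_iff)
      then have "ennreal (\<epsilon> / 2) < (SUP t\<in>T. ennreal (d (\<beta>hat n t \<omega>) \<beta>))"
        using S by auto
      then obtain t where t: "t \<in> T" and "ennreal (\<epsilon> / 2) < ennreal (d (\<beta>hat n t \<omega>) \<beta>)"
        by (auto simp: less_SUP_iff)
      then have far: "d (\<beta>hat n t \<omega>) \<beta> \<ge> \<epsilon> / 2"
        using \<open>\<epsilon> > 0\<close> by (simp add: ennreal_less_iff)
      have "t \<ge> 0" using t assms(12) by auto
      then have bh: "\<beta>hat n t \<omega> \<in> \<Phi>" by (rule assms(13)[OF _ \<omega>])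
      have a: "M (\<beta>hat n t \<omega>) - Mn n (\<beta>hat n t \<omega>) \<omega> < \<eta>"
        by (rule less_if_SUP_pos_part_less[OF _ bh]) (use out \<omega> in auto)
      have b: "\<Lambda> n (\<beta>hat n t \<omega>) t \<omega> - \<Lambda> n \<beta> t \<omega> < \<eta>"
        by (rule less_if_SUP_pos_part_less[OF _ t]) (use out \<omega> in auto)
      have c: "\<bar>Mn n \<beta> \<omega> - M \<beta>\<bar> < \<eta>"
        using out \<omega> by (auto simp: ennreal_le_iff)
      have pen: "t * J n \<beta> \<le> K * J n \<beta>"
        using K[OF t] assms(8)[OF assms(4)] by (rule mult_right_mono)
      have "t * J n (\<beta>hat n t \<omega>) \<ge> 0"
        using \<open>t \<ge> 0\<close> assms(8)[OF bh] by simp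
      then have "M (\<beta>hat n t \<omega>) < M \<beta> + 4 * \<eta>"
        using a b c pen elim assms(10)[OF bh \<open>t \<ge> 0\<close> \<omega>, of n]
          assms(10)[OF assms(4) \<open>t \<ge> 0\<close> \<omega>, of n]
        by linarith
      then have "M (\<beta>hat n t \<omega>) < m"
        by (simp add: \<eta>_def field_simps)
      with m_le[OF bh far] show False by simp
    qed
  qed
  have "outer_prob_tendsto_0 P (\<lambda>n \<omega>. ennreal \<bar>Mn n \<beta> \<omega> - M \<beta>\<bar>)"
    using assms(1) assms(3)[OF assms(4)] assms(6) by (rule tendsto_in_prob_imp_outer_prob)
  with assms(5,14) \<eta> have "(\<lambda>n. outer_measure_of P (?A n)) \<longlonglongrightarrow> 0"
    "(\<lambda>n. outer_measure_of P (?B n)) \<longlonglongrightarrow> 0" "(\<lambda>n. outer_measure_of P (?C n)) \<longlonglongrightarrow> 0"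
    unfolding outer_prob_tendsto_0_def by blast+
  then show "(\<lambda>n. outer_measure_of P (?S n)) \<longlonglongrightarrow> 0"
    using cover by (rule outer_measure_tendsto_0_cover3)
qed

end
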